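(* Let $q$ be a power of an odd prime $p$, and let $e$ be an integer with $0\le e<q$. In the polynomial ring $\mathbb{Z}[\beta]$, set $x=\beta(1-\beta)$ and $\alpha=1-\beta$. Then \[ \sum_{0\le k<(q-e)/2}\binom{2k+e}{k}x^k\equiv\frac{\alpha^{q-e}-\beta^{q-e}}{\alpha-\beta}\pmod{p}, \] and \[ \sum_{0\le k<q}\binom{2k+e}{k}x^k\equiv\frac{\alpha^{2q-e}-\beta^{2q-e}}{\alpha-\beta}\pmod{p}. \] (The right-hand sides are polynomials in $\beta$ with integer coefficients, since $\alpha-\beta$ divides $\alpha^n-\beta^n$.) *)

theory Defs
  imports "HOL-Computational_Algebra.Computational_Algebra"
begin

text \<open>
  On \<^typ>\<open>int poly\<close>, \<open>div\<close> is the exact division of \<^class>\<open>idom_divide\<close>: it is meaningful only when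
  the divisor divides the dividend. The lemma below shows that it does for the
  quotients \<open>(a ^ n - b ^ n) div (a - b)\<close>.
\<close>

lemma diff_power_div_exact:
  fixes a b :: "int poly"
  shows "(a - b) * ((a ^ n - b ^ n) div (a - b)) = a ^ n - b ^ n"
proof -
  have "(a - b) dvd (a ^ n - b ^ n)"
    by (metis dvd_triv_left power_diff_sumr2)
  then show ?thesis
    by simp
qed

text \<open>
  Congruence modulo the ideal generated by \<open>m\<close>. The library constant \<open>cong\<close> lives in the class
  \<^class>\<open>unique_euclidean_semiring\<close>, to which \<^typ>\<open>int poly\<close> does not belong.
\<close>

definition pcong :: "int poly \<Rightarrow> int poly \<Rightarrow> int poly \<Rightarrow> bool" where
  "pcong m f g \<longleftrightarrow> m dvd (f - g)"

end

theory Submission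
  imports Defs
begin

text \<open>
  Since \<open>\<alpha> + \<beta> = 1\<close> and \<open>\<alpha> \<beta> = x\<close>, the quotient \<open>(\<alpha>^(n+1) - \<beta>^(n+1)) / (\<alpha> - \<beta>)\<close> is the Fibonacci-type
  polynomial \<open>\<Sum>j. (n - j choose j) (- x)^j\<close>. For \<open>n = N - e - 1\<close> with \<open>q\<close> dividing \<open>N\<close>, and \<open>j < q\<close>,
  the upper index \<open>N - e - 1 - j\<close> may be replaced modulo \<open>p\<close> by \<open>- e - 1 - j\<close>; negating the upper index
  then gives \<open>(-1)^j (- e - 1 - j choose j) = (2 j + e choose j)\<close>. The two claims are \<open>N = q\<close> and \<open>N = 2 q\<close>.
\<close>

text \<open>With \<open>y = - (a * b)\<close>, both \<open>a\<close> and \<open>b\<close> are roots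
  of \<open>t^2 = t + y\<close>, so the right side obeys the recurrence \<open>W_rec\<close>. The
  two sides agree at 0 and 1.\<close>

lemma diff_mult_sum_binomial_diagonal:
  fixes a b :: "'a::comm_ring_1"
  assumes "a + b = 1"
  shows "(a - b) * (\<Sum>j\<le>n. of_nat ((n - j) choose j) * (- (a * b)) ^ j) = a ^ Suc n - b ^ Suc n"
proof -
  define y where "y = - (a * b)"
  define W where "W n = (\<Sum>j\<le>n. of_nat ((n - j) choose j) * y ^ j)" for n
  have W_Suc: "W (Suc n) = 1 + (\<Sum>j\<le>n. of_nat ((n - j) choose Suc j) * y ^ Suc j)" for n
    unfolding W_def by (subst sum.atMost_Suc_shift) simp
  have W_rec: "W (Suc (Suc n)) = W (Suc n) + y * W n" for n
  proof -
    have "W (Suc (Suc n)) = 1 + (\<Sum>j\<le>Suc n. of_nat ((Suc n - j) choose Suc j) * y ^ Suc j)"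
      by (rule W_Suc)
    also have "\<dots> = 1 + (\<Sum>j\<le>n. of_nat ((Suc n - j) choose Suc j) * y ^ Suc j)"
      by simp
    \<comment> \<open>Pascal's rule, using \<open>Suc n - j = Suc (n - j)\<close> for
      \<open>j \<le> n\<close>.\<close>
    also have "\<dots> = 1 + (\<Sum>j\<le>n. of_nat ((n - j) choose Suc j) * y ^ Suc j
        + y * (of_nat ((n - j) choose j) * y ^ j))"
      by (intro arg_cong2[where f = "(+)"] refl sum.cong) (simp_all add: Suc_diff_le algebra_simps)
    also have "\<dots> = W (Suc n) + y * W n"
      by (simp add: W_Suc W_def[of n] sum.distrib sum_distrib_left)
    finally show ?thesis .
  qed
  have b: "b = 1 - a"
    using assms by (simp add: algebra_simps)
  have "(a - b) * W n = a ^ Suc n - b ^ Suc n"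
  proof (induction n rule: induct_nat_012)
    case 0
    show ?case by (simp add: W_def)
  next
    case 1
    show ?case by (simp add: W_def b algebra_simps)
  next
    case (ge2 n)
    have "(a - b) * W (Suc (Suc n)) = (a - b) * W (Suc n) + y * ((a - b) * W n)"
      by (simp add: W_rec algebra_simps)
    also have "\<dots> = a ^ Suc (Suc (Suc n)) - b ^ Suc (Suc (Suc n))"
      unfolding ge2 by (simp add: y_def b algebra_simps)
    finally show ?case .
  qed
  then show ?thesis
    by (simp add: W_def y_def)
qed

text \<open>In \<open>i * (N choose i) = N * ((N - 1) choose (i - 1))\<close> the right side is
  divisible by \<open>p ^ m\<close>. If \<open>p\<close> did not divide \<open>N choose i\<close>,
  then \<open>p ^ m\<close> would divide \<open>i\<close>, which is too small.\<close>

lemma prime_dvd_binomial_of_prime_power_dvd: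
  fixes p :: nat
  assumes p: "prime p" and N: "p ^ m dvd N" and i: "0 < i" "i < p ^ m"
  shows "p dvd (N choose i)"
proof (rule ccontr)
  assume "\<not> p dvd (N choose i)"
  then have "coprime (p ^ m) (N choose i)"
    using p by (simp add: prime_imp_coprime)
  moreover have "i * (N choose i) = N * ((N - 1) choose (i - 1))"
    using times_binomial_minus1_eq[OF i(1)] .
  then have "p ^ m dvd i * (N choose i)"
    using N by simp
  ultimately have "p ^ m dvd i"
    by (simp add: coprime_dvd_mult_left_iff)
  then show False
    using i by (simp add: nat_dvd_not_less)
qed

text \<open>Vandermonde's convolution for \<open>n = N + (n - N)\<close> with the negative upper index \<open>n - N = - (c + 1)\<close> reflected.\<close>

lemma binomial_eq_sum_reflected:
  fixes n N c j :: nat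
  assumes "n + c + 1 = N"
  shows "int (n choose j) =
    (\<Sum>i\<le>j. int (N choose i) * ((-1) ^ (j - i) * int ((c + (j - i)) choose (j - i))))"
proof -
  have reflect: "(- (1 + real c)) gchoose l = (-1) ^ l * real ((c + l) choose l)" for l
    by (subst gbinomial_negated_upper) (simp add: binomial_gbinomial algebra_simps)
  have "real n = real N + - (1 + real c)"
    using assms by auto
  then have "real (n choose j) = (real N + - (1 + real c)) gchoose j"
    by (simp add: binomial_gbinomial)
  also have "\<dots> = (\<Sum>i\<le>j. (real N gchoose i) * ((- (1 + real c)) gchoose (j - i)))"
    by (simp add: gbinomial_Vandermonde atMost_atLeast0)
  also have "\<dots> = of_int (\<Sum>i\<le>j. int (N choose i) * ((-1) ^ (j - i) * int ((c + (j - i)) choose (j - i))))"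
    unfolding reflect by (simp flip: binomial_gbinomial)
  finally show ?thesis
    by (metis of_int_eq_iff of_int_of_nat_eq)
qed

text \<open>Modulo \<open>p\<close> only the term \<open>i = 0\<close> of the convolution survives,
  since \<open>0 < i \<le> j < p ^ m\<close> makes \<open>N choose i\<close> divisible by
  \<open>p\<close>.\<close>

lemma prime_dvd_binomial_diff_reflected:
  fixes p m n N c j :: nat
  assumes p: "prime p" and N: "p ^ m dvd N" and j: "j < p ^ m" and n: "n + c + 1 = N"
  shows "int p dvd int ((c + j) choose j) - (-1) ^ j * int (n choose j)"
proof -
  define t where "t i = int (N choose i) * ((-1) ^ (j - i) * int ((c + (j - i)) choose (j - i)))" for i
  have "int (n choose j) = (\<Sum>i\<le>j. t i)"
    unfolding t_def using n by (rule binomial_eq_sum_reflected)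
  also have "\<dots> = t 0 + (\<Sum>i\<in>{..j} - {0}. t i)"
    by (simp add: sum.remove[of _ 0])
  finally have "int ((c + j) choose j) - (-1) ^ j * int (n choose j)
      = - ((-1) ^ j * (\<Sum>i\<in>{..j} - {0}. t i))"
    by (simp add: t_def algebra_simps flip: power_add mult_2)
  moreover have "int p dvd (\<Sum>i\<in>{..j} - {0}. t i)"
  proof (rule dvd_sum)
    fix i assume "i \<in> {..j} - {0}"
    then have "p dvd (N choose i)"
      using prime_dvd_binomial_of_prime_power_dvd[OF p N, of i] j by auto
    then show "int p dvd t i"
      by (simp add: t_def)
  qed
  ultimately show ?thesis
    by simp
qed

text \<open>The set \<open>K\<close> is left free so that both claims are instances. It must lie
  where the termwise congruence holds and contain every index at which the quotient has a nonzero
  term.\<close>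

lemma pcong_sum_binomial_quotient:
  fixes p m N e :: nat and a b :: "int poly"
  assumes p: "prime p" and N: "p ^ m dvd N" and e: "e < N"
    and ab: "a + b = 1" "a \<noteq> b"
    and K: "K \<subseteq> {..<p ^ m}" "K \<subseteq> {..<N - e}" "\<And>k. 2 * k < N - e \<Longrightarrow> k \<in> K"
  shows "pcong (of_nat p) (\<Sum>k\<in>K. of_nat ((2 * k + e) choose k) * (a * b) ^ k)
    ((a ^ (N - e) - b ^ (N - e)) div (a - b))"
proof -
  define n where "n = N - e - 1"
  have n: "N - e = Suc n"
    using e by (simp add: n_def)
  have "(a ^ (N - e) - b ^ (N - e)) div (a - b) = (\<Sum>j\<le>n. of_nat ((n - j) choose j) * (- (a * b)) ^ j)"
    unfolding n using ab diff_mult_sum_binomial_diagonal[of a b n, symmetric] by simp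
  also have "\<dots> = (\<Sum>j\<in>K. of_nat ((n - j) choose j) * (- (a * b)) ^ j)"
  proof (rule sum.mono_neutral_right)
    show "K \<subseteq> {..n}"
      using K(2) n by auto
    show "\<forall>j\<in>{..n} - K. of_nat ((n - j) choose j) * (- (a * b)) ^ j = 0"
    proof
      fix j assume "j \<in> {..n} - K"
      then have "\<not> 2 * j < N - e"
        using K(3) by blast
      then have "n - j < j"
        using n by linarith
      then show "of_nat ((n - j) choose j) * (- (a * b)) ^ j = 0"
        by simp
    qed
  qed simp
  finally have quotient: "(a ^ (N - e) - b ^ (N - e)) div (a - b)
      = (\<Sum>j\<in>K. of_nat ((n - j) choose j) * (- (a * b)) ^ j)" .
  show ?thesis
    unfolding pcong_def quotient sum_subtractf[symmetric]
  proof (rule dvd_sum)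
    fix k assume k: "k \<in> K"
    define d where "d = int ((2 * k + e) choose k) - (-1) ^ k * int ((n - k) choose k)"
    \<comment> \<open>The reflected index is \<open>c = k + e\<close>, so that
      \<open>c + k = 2 * k + e\<close>.\<close>
    have "k < p ^ m" "(n - k) + (k + e) + 1 = N"
      using k K n by auto
    from prime_dvd_binomial_diff_reflected[OF p N this] have "int p dvd d"
      by (simp add: d_def mult_2 add.commute add.left_commute)
    then have "(of_nat p :: int poly) dvd of_int d"
      by (metis dvd_def of_int_mult of_int_of_nat_eq)
    moreover have "of_nat ((2 * k + e) choose k) * (a * b) ^ k - of_nat ((n - k) choose k) * (- (a * b)) ^ k
        = of_int d * (a * b) ^ k"
      by (subst power_minus) (simp add: d_def algebra_simps)
    ultimately show "of_nat p dvd of_nat ((2 * k + e) choose k) * (a * b) ^ k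
        - of_nat ((n - k) choose k) * (- (a * b)) ^ k"
      by simp
  qed
qed

theorem theorem3p1:
  fixes p q m e :: nat and x \<alpha> \<beta> :: "int poly"
  assumes "prime p" and "odd p" and "q = p ^ m" and "e < q"
    and "\<beta> = [:0, 1:]" and "x = \<beta> * (1 - \<beta>)" and "\<alpha> = 1 - \<beta>"
  shows "pcong (of_nat p)
           (\<Sum>k | 2 * k < q - e. of_nat ((2 * k + e) choose k) * x ^ k)
           ((\<alpha> ^ (q - e) - \<beta> ^ (q - e)) div (\<alpha> - \<beta>))
       \<and> pcong (of_nat p)
           (\<Sum>k<q. of_nat ((2 * k + e) choose k) * x ^ k)
           ((\<alpha> ^ (2 * q - e) - \<beta> ^ (2 * q - e)) div (\<alpha> - \<beta>))"
proof -
  have x: "x = \<alpha> * \<beta>" and ab: "\<alpha> + \<beta> = 1"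
    using assms by simp_all
  \<comment> \<open>The values at 0 are 1 and 0.\<close>
  have "poly \<alpha> 0 \<noteq> poly \<beta> 0"
    using assms by simp
  then have ne: "\<alpha> \<noteq> \<beta>"
    by auto
  \<comment> \<open>For \<open>N = 2 * q\<close> the range \<open>k < q\<close> is admissible:
    \<open>e < q\<close> gives \<open>q < 2 * q - e\<close>, and \<open>2 * k < 2 * q - e\<close>
    forces \<open>k < q\<close>.\<close>
  show ?thesis
    unfolding x
    using assms(3,4)
    by (intro conjI pcong_sum_binomial_quotient[where m = m, OF assms(1) _ _ ab ne]) auto
qed

end
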